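(* Let $\ell\ge2$ and $k\ge0$. The map $\Upsilon_\ell^k$, which deletes the first column of the diagram of a partition, is a bijection $$\Upsilon_\ell^k:\{\text{partitions }\nu:\ \nu_1\le\ell-1,\ len(\nu)=k\}\to\{\text{partitions }\sigma:\ \sigma_1\le\ell-2,\ len(\sigma)\le k\},$$ and it satisfies $$\Upsilon_\ell^k\circ\rho_\ell=\rho_{\ell-1}\circ\widetilde{\Phi_\ell^k}$$ on the set of $\ell$-cores $\lambda$ with $len(\lambda)=k$, where $\widetilde{\Phi_\ell^k}=tr\circ\Phi_\ell^k\circ tr$.
   Context: $len(\lambda)$ is the number of nonzero parts of $\lambda$, $tr$ is transposition of partitions. The hook length of a box is the number of boxes to its right and below it (same row or column), including itself. An $\ell$-core is a partition with no hook length divisible by $\ell$. Bijection $\Phi_\ell^k$. An ($\ell$-)abacus has runners (columns) $0,\dots,\ell-1$ and levels (rows) $r\in\mathbb Z$; the entry on runner $j$, level $r$ is the integer $r\ell+j$. Some entries are beads, the others gaps, such that all sufficiently small integers are beads and all sufficiently large ones are gaps. An abacus determines a partition: its parts are, for each bead, the number of gaps preceding it in the linear order of the integers (discarding zeros). $\Phi_\ell^k$ maps $\ell$-cores with first part $k$ to $(\ell-1)$-cores with first part $\le k$: given any abacus of $\lambda$, delete the whole runner containing the largest bead and place the remaining runners in order (levels unchanged) into an $(\ell-1)$-abacus; $\Phi_\ell^k(\lambda)$ is the corresponding $(\ell-1)$-core (independent of the choice of abacus). Equivalently, $\Phi_\ell^k$ removes all rows of $\lambda$ whose first-column hook length is congruent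 mod $\ell$ to that of the first row. Thus $\widetilde{\Phi_\ell^k}=tr\circ\Phi_\ell^k\circ tr$ maps $\ell$-cores of length $k$ to $(\ell-1)$-cores of length $\le k$. Lapointe–Morse bijection $\rho_\ell:\{\ell\text{-cores}\}\to\{\text{partitions with first part}\le\ell-1\}$: $\rho_\ell(\lambda)$ is obtained by left-justifying the rows of the skew diagram $\lambda/\gamma$, where $\gamma$ consists of the boxes of $\lambda$ with hook length $>\ell$; i.e. the $i$-th part of $\rho_\ell(\lambda)$ is the number of boxes in row $i$ of $\lambda$ with hook length $<\ell$. $\rho_{\ell-1}$ is the same with $\ell-1$ in place of $\ell$. *)

theory Defs
  imports Main
begin

text \<open>
  A partition is the weakly decreasing list of its positive parts, so the number of
  (nonzero) parts is the length of the list. Boxes of the diagram are pairs (row, column),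
  both numbered from 0.
\<close>

definition is_partition :: "nat list \<Rightarrow> bool" where
  "is_partition p \<longleftrightarrow> sorted_wrt (\<ge>) p \<and> 0 \<notin> set p"

definition first_part :: "nat list \<Rightarrow> nat" where
  "first_part p = (case p of [] \<Rightarrow> 0 | x # _ \<Rightarrow> x)"

definition diagram :: "nat list \<Rightarrow> (nat \<times> nat) set" where
  "diagram p = {(i, j). i < length p \<and> j < p ! i}"

definition tr :: "nat list \<Rightarrow> nat list" where
  "tr p = map (\<lambda>j. card {i. (i, j) \<in> diagram p}) [0..<first_part p]"

definition hook_length :: "nat list \<Rightarrow> nat \<Rightarrow> nat \<Rightarrow> nat" where
  "hook_length p i j =
     card {(i', j') \<in> diagram p. (i' = i \<and> j \<le> j') \<or> (j' = j \<and> i \<le> i')}"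

definition core :: "nat \<Rightarrow> nat list \<Rightarrow> bool" where
  "core l p \<longleftrightarrow> is_partition p \<and> (\<forall>(i, j) \<in> diagram p. \<not> l dvd hook_length p i j)"

text \<open>
  An abacus is represented by its set of beads; for any number \<open>l\<close> of runners, the integer
  \<open>b\<close> sits on runner \<open>b mod l\<close> at level \<open>b div l\<close>.
\<close>

definition abacus :: "int set \<Rightarrow> bool" where
  "abacus B \<longleftrightarrow> (\<exists>m. \<forall>b < m. b \<in> B) \<and> (\<exists>m. \<forall>b > m. b \<notin> B)"

text \<open>
  Only the finitely many beads preceded by some gap contribute a nonzero part; they are read
  from the largest bead downwards, which makes the parts weakly decreasing.
\<close>

definition abacus_partition :: "int set \<Rightarrow> nat list" where
  "abacus_partition B =
     map (\<lambda>b. card {g. g < b \<and> g \<notin> B}) (rev (sorted_list_of_set {b \<in> B. \<exists>g < b. g \<notin> B}))"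

text \<open>
  Deleting runner \<open>c\<close> from an \<open>l\<close>-abacus: levels are kept, and the runners to the right of
  \<open>c\<close> move one place to the left.
\<close>

definition delete_runner :: "nat \<Rightarrow> int \<Rightarrow> int set \<Rightarrow> int set" where
  "delete_runner l c B =
     {(b div int l) * (int l - 1) + (if b mod int l < c then b mod int l else b mod int l - 1)
       | b. b \<in> B \<and> b mod int l \<noteq> c}"

definition delete_largest_bead_runner :: "nat \<Rightarrow> int set \<Rightarrow> int set" where
  "delete_largest_bead_runner l B = delete_runner l ((GREATEST b. b \<in> B) mod int l) B"

text \<open>
  The definite description ranges over all abaci of \<open>p\<close>, so it denotes the intended partition
  because the result does not depend on the choice of abacus. The superscript \<open>k\<close> of
  \<open>\<Phi>\<close> and \<open>\<Upsilon>\<close> only fixes the domain and codomain, hence it is not an argument here.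
\<close>

definition Phi :: "nat \<Rightarrow> nat list \<Rightarrow> nat list" where
  "Phi l p = (THE q. \<exists>B. abacus B \<and> abacus_partition B = p \<and>
                         q = abacus_partition (delete_largest_bead_runner l B))"

definition Phi_tilde :: "nat \<Rightarrow> nat list \<Rightarrow> nat list" where
  "Phi_tilde l = tr \<circ> Phi l \<circ> tr"

text \<open>
  On an \<open>l\<close>-core no hook length equals \<open>l\<close>, so the counted boxes are exactly those outside the
  sub-diagram of boxes with hook length greater than \<open>l\<close>, and every row contains at least one
  of them (so no zero parts arise).
\<close>

definition rho :: "nat \<Rightarrow> nat list \<Rightarrow> nat list" where
  "rho l p = map (\<lambda>i. card {j. (i, j) \<in> diagram p \<and> hook_length p i j < l}) [0..<length p]"

definition Upsilon :: "nat list \<Rightarrow> nat list" where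
  "Upsilon p = filter (\<lambda>x. 0 < x) (map (\<lambda>x. x - 1) p)"

end

theory Submission
  imports Defs
begin

text \<open>
  Describe a core \<open>\<lambda>\<close> by an abacus \<open>A\<close>. Transposing a partition reflects its abacus and exchanges
  beads with gaps, so \<open>tr \<circ> \<Phi> \<circ> tr\<close> deletes the runner of the least gap \<open>m\<close> of \<open>A\<close>.
  The hook length of the box belonging to a bead \<open>b\<close> and a gap \<open>g < b\<close> is \<open>b - g\<close>; hence the row
  of \<open>\<rho> \<lambda>\<close> belonging to \<open>b\<close> counts the gaps in the window \<open>(b - l, b)\<close>. As \<open>\<lambda>\<close> is a core, all
  beads of each runner lie below all of its gaps. So the window contains exactly one gap on the
  runner of \<open>m\<close>, and deleting that runner lowers every row by exactly one, while the rows that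
  become zero are those of beads which no longer have a gap below them.
\<close>

section \<open>Sorted enumerations and counting by index\<close>

lemma sorted_list_of_set_eqI:
  fixes xs :: "'a :: linorder list"
  assumes "sorted_wrt (<) xs" "set xs = S"
  shows "sorted_list_of_set S = xs"
  using assms by (auto intro!: strict_sorted_equal)

lemma sorted_list_of_set_image:
  fixes S :: "int set" and \<phi> :: "int \<Rightarrow> int"
  assumes "finite S" "strict_mono_on S \<phi>"
  shows "sorted_list_of_set (\<phi> ` S) = map \<phi> (sorted_list_of_set S)"
proof (rule sorted_list_of_set_eqI)
  show "sorted_wrt (<) (map \<phi> (sorted_list_of_set S))"
    unfolding sorted_wrt_map
    by (rule sorted_wrt_mono_rel[OF _ strict_sorted_list_of_set])
       (use assms in \<open>auto simp: strict_mono_on_def\<close>)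
qed (use assms in auto)

lemma sorted_list_of_set_uminus:
  fixes S :: "int set"
  assumes "finite S"
  shows "sorted_list_of_set (uminus ` S) = rev (map uminus (sorted_list_of_set S))"
proof (rule sorted_list_of_set_eqI)
  show "sorted_wrt (<) (rev (map uminus (sorted_list_of_set S)))"
    unfolding sorted_wrt_rev sorted_wrt_map
    by (rule sorted_wrt_mono_rel[OF _ strict_sorted_list_of_set]) auto
qed (use assms in auto)

lemma filter_sorted_list_of_set:
  fixes S :: "int set"
  assumes "finite S"
  shows "filter P (sorted_list_of_set S) = sorted_list_of_set {x \<in> S. P x}"
  by (rule sorted_list_of_set_eqI[symmetric])
     (use assms in \<open>auto intro: sorted_wrt_filter\<close>)

text \<open>Translates counts of row or column indices into counts of beads or gaps.\<close>

lemma card_nth_indices: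
  assumes "distinct xs"
  shows "card {i. i < length xs \<and> P (xs ! i)} = card {x \<in> set xs. P x}"
  using distinct_card[of "filter P xs"] assms by (simp add: length_filter_conv_card)

text \<open>A member \<open>j\<close> brings the \<open>j + 1\<close> numbers \<open>{..j}\<close>
  with it, so \<open>j < card J\<close>; equality then follows by counting.\<close>

lemma initial_segment:
  fixes J :: "nat set"
  assumes fin: "finite J" and down: "\<And>j j'. j \<in> J \<Longrightarrow> j' \<le> j \<Longrightarrow> j' \<in> J"
  shows "J = {..<card J}"
proof (rule card_subset_eq)
  show "J \<subseteq> {..<card J}"
  proof
    fix j assume "j \<in> J"
    then have "{..j} \<subseteq> J" using down by auto
    from card_mono[OF fin this] show "j \<in> {..<card J}" by simp
  qed
qed simp_all

subsection \<open>Partitions of beads and gaps\<close>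

text \<open>
  Beads and gaps need not exhaust the integers: this describes an abacus with a runner left out
  without renumbering the remaining positions.
\<close>

definition part_of :: "int set \<Rightarrow> int set \<Rightarrow> nat list" where
  "part_of A G = map (\<lambda>b. card {g \<in> G. g < b})
     (rev (sorted_list_of_set {b \<in> A. \<exists>g \<in> G. g < b}))"

lemma abacus_partition_eq: "abacus_partition B = part_of B (- B)"
proof -
  have "{b \<in> B. \<exists>g < b. g \<notin> B} = {b \<in> B. \<exists>g \<in> - B. g < b}" by auto
  moreover have "{g. g < b \<and> g \<notin> B} = {g \<in> - B. g < b}" for b by auto
  ultimately show ?thesis by (simp add: abacus_partition_def part_of_def)
qed

text \<open>\<open>part_of\<close> depends only on the relative order of beads and gaps. This covers
  both shifting an abacus and renumbering its positions after a runner has been left out.\<close>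

lemma part_of_image:
  assumes mono: "strict_mono_on (A \<union> G) \<phi>" and fin: "finite {b \<in> A. \<exists>g \<in> G. g < b}"
  shows "part_of (\<phi> ` A) (\<phi> ` G) = part_of A G"
proof -
  have less: "\<phi> x < \<phi> y \<longleftrightarrow> x < y" if "x \<in> A \<union> G" "y \<in> A \<union> G" for x y
    using strict_mono_on_less[OF mono] that by blast
  have rows: "{b \<in> \<phi> ` A. \<exists>g \<in> \<phi> ` G. g < b} = \<phi> ` {b \<in> A. \<exists>g \<in> G. g < b}"
    using less by auto
  have mono': "strict_mono_on {b \<in> A. \<exists>g \<in> G. g < b} \<phi>"
    by (rule monotone_on_subset[OF mono]) auto
  have card: "card {g \<in> \<phi> ` G. g < \<phi> b} = card {g \<in> G. g < b}" if "b \<in> A" for b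
  proof -
    have "{g \<in> \<phi> ` G. g < \<phi> b} = \<phi> ` {g \<in> G. g < b}" using less that by auto
    moreover have "inj_on \<phi> {g \<in> G. g < b}"
      by (rule inj_on_subset[OF strict_mono_on_imp_inj_on[OF mono]]) auto
    ultimately show ?thesis by (simp add: card_image)
  qed
  show ?thesis
    unfolding part_of_def rows sorted_list_of_set_image[OF fin mono']
    using card fin by (simp add: rev_map)
qed

section \<open>Diagram, transpose and hook lengths in terms of beads and gaps\<close>

locale beads_gaps =
  fixes A G :: "int set"
  assumes fin_rows: "finite {b \<in> A. \<exists>g \<in> G. g < b}"
    and fin_cols: "finite {g \<in> G. \<exists>b \<in> A. g < b}"
begin

text \<open>Row \<open>i\<close> of the diagram belongs to the \<open>i\<close>-th largest bead
  above some gap, counted from 0, and column \<open>j\<close> to the \<open>j\<close>-th smallest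
  gap below some bead. Hence \<open>rows\<close> is decreasing and \<open>cols\<close>
  increasing.\<close>

definition rows :: "int list" where
  "rows = rev (sorted_list_of_set {b \<in> A. \<exists>g \<in> G. g < b})"

definition cols :: "int list" where
  "cols = sorted_list_of_set {g \<in> G. \<exists>b \<in> A. g < b}"

lemma set_rows: "set rows = {b \<in> A. \<exists>g \<in> G. g < b}"
  using fin_rows by (simp add: rows_def)

lemma set_cols: "set cols = {g \<in> G. \<exists>b \<in> A. g < b}"
  using fin_cols by (simp add: cols_def)

lemma distinct_rows: "distinct rows" and distinct_cols: "distinct cols"
  by (simp_all add: rows_def cols_def)

lemma rows_less_iff: "i < length rows \<Longrightarrow> i' < length rows \<Longrightarrow> rows ! i' < rows ! i \<longleftrightarrow> i < i'"
proof -
  have "sorted_wrt (>) rows" by (simp add: rows_def sorted_wrt_rev)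
  then show "i < length rows \<Longrightarrow> i' < length rows \<Longrightarrow> rows ! i' < rows ! i \<longleftrightarrow> i < i'"
    unfolding sorted_wrt_iff_nth_less by (metis linorder_neqE_nat order_less_asym order_less_irrefl)
qed

lemma cols_less_iff: "j < length cols \<Longrightarrow> j' < length cols \<Longrightarrow> cols ! j < cols ! j' \<longleftrightarrow> j < j'"
proof -
  have "sorted_wrt (<) cols" by (simp add: cols_def)
  then show "j < length cols \<Longrightarrow> j' < length cols \<Longrightarrow> cols ! j < cols ! j' \<longleftrightarrow> j < j'"
    unfolding sorted_wrt_iff_nth_less by (metis linorder_neqE_nat order_less_asym order_less_irrefl)
qed

lemma rows_nth: "i < length rows \<Longrightarrow> rows ! i \<in> A"
  using nth_mem[of i rows] by (simp add: set_rows)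

lemma cols_nth: "j < length cols \<Longrightarrow> cols ! j \<in> G"
  using nth_mem[of j cols] by (simp add: set_cols)

lemma part_of_rows: "part_of A G = map (\<lambda>b. card {g \<in> G. g < b}) rows"
  by (simp add: part_of_def rows_def)

lemma card_cols_below:
  assumes "b \<in> A"
  shows "card {g \<in> G. g < b} = card {j. j < length cols \<and> cols ! j < b}"
proof -
  have "{g \<in> G. g < b} = {g \<in> set cols. g < b}" using assms by (auto simp: set_cols)
  then show ?thesis using card_nth_indices[OF distinct_cols, of "\<lambda>g. g < b"] by simp
qed

lemma card_rows_above:
  assumes "g \<in> G"
  shows "card {b \<in> A. g < b} = card {i. i < length rows \<and> g < rows ! i}"
proof -
  have "{b \<in> A. g < b} = {b \<in> set rows. g < b}" using assms by (auto simp: set_rows)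
  then show ?thesis by (simp add: card_nth_indices[OF distinct_rows])
qed

text \<open>As \<open>cols\<close> increases, the columns whose gap lies below a given bead form an
  initial segment, and its size is the part belonging to that bead.\<close>

lemma diagram_iff:
  "(i, j) \<in> diagram (part_of A G) \<longleftrightarrow> i < length rows \<and> j < length cols \<and> cols ! j < rows ! i"
proof (cases "i < length rows")
  case True
  let ?J = "{j. j < length cols \<and> cols ! j < rows ! i}"
  have "j' \<in> ?J" if "j \<in> ?J" "j' \<le> j" for j j'
    using that cols_less_iff[of j' j] by (cases "j' = j") auto
  then have n: "?J = {..<card ?J}" by (intro initial_segment) auto
  have "part_of A G ! i = card ?J"
    using True by (simp add: part_of_rows card_cols_below[OF rows_nth])
  then show ?thesis using True n by (auto simp: diagram_def part_of_rows)
qed (simp add: diagram_def part_of_rows)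

text \<open>The bead of row 0 is the largest, so it lies above every gap that occurs in
  \<open>cols\<close>.\<close>

lemma first_part_part_of: "first_part (part_of A G) = length cols"
proof (cases "rows = []")
  case True
  then have "set cols = {}" using set_rows set_cols by auto
  then show ?thesis using True by (simp add: part_of_rows first_part_def)
next
  case False
  have "(0, j) \<in> diagram (part_of A G) \<longleftrightarrow> j < length cols" for j
  proof -
    have "cols ! j < rows ! 0" if j: "j < length cols"
    proof -
      obtain b where b: "b \<in> A" "cols ! j < b" using nth_mem[OF j] set_cols by auto
      then have "b \<in> set rows" using cols_nth[OF j] set_rows by auto
      then obtain i where "i < length rows" "b = rows ! i" by (metis in_set_conv_nth)
      then have "b \<le> rows ! 0" using rows_less_iff[of i 0] False by fastforce
      with b show ?thesis by simp
    qed
    then show ?thesis using False diagram_iff by auto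
  qed
  moreover have "(0, j) \<in> diagram (part_of A G) \<longleftrightarrow> j < first_part (part_of A G)" for j
    using False by (cases "part_of A G") (auto simp: diagram_def first_part_def part_of_rows)
  ultimately show ?thesis by (metis linorder_neqE_nat order_less_irrefl)
qed

text \<open>Negation reverses the enumeration and \<open>part_of\<close> reverses it again, so the
  reflected gaps are read in the order of \<open>cols\<close>. The right-hand side lists the column
  lengths of the original diagram.\<close>

lemma part_of_uminus: "part_of (uminus ` G) (uminus ` A) = map (\<lambda>g. card {b \<in> A. g < b}) cols"
proof -
  have "{b \<in> uminus ` G. \<exists>g \<in> uminus ` A. g < b} = uminus ` {g \<in> G. \<exists>b \<in> A. g < b}" by force
  moreover have "card {x \<in> uminus ` A. x < - g} = card {b \<in> A. g < b}" for g
  proof -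
    have "{x \<in> uminus ` A. x < - g} = uminus ` {b \<in> A. g < b}" by auto
    then show ?thesis by (simp add: card_image)
  qed
  ultimately show ?thesis
    by (simp add: part_of_def sorted_list_of_set_uminus[OF fin_cols] cols_def)
qed

lemma tr_part_of: "tr (part_of A G) = part_of (uminus ` G) (uminus ` A)"
proof -
  have "card {i. (i, j) \<in> diagram (part_of A G)} = card {b \<in> A. cols ! j < b}"
    if "j < length cols" for j
    using that by (simp add: diagram_iff card_rows_above cols_nth)
  then show ?thesis
    by (auto simp: tr_def part_of_uminus first_part_part_of intro!: nth_equalityI)
qed

text \<open>The arm counts the gaps and the leg the beads in the interval from the gap up to, but
  excluding, the bead. Every integer there is exactly one of the two, so the hook length is the
  length of the interval.\<close>

lemma hook_length_eq:
  assumes G: "G = - A" and ij: "(i, j) \<in> diagram (part_of A G)"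
  shows "int (hook_length (part_of A G) i j) = rows ! i - cols ! j"
proof -
  let ?p = "part_of A G" and ?b = "rows ! i" and ?g = "cols ! j"
  have i: "i < length rows" and j: "j < length cols" and gb: "?g < ?b"
    using ij diagram_iff by auto
  \<comment> \<open>The corner box is counted in \<open>?arm\<close> only: \<open>\<le>\<close>
    admits it there, and the strict bound on \<open>rows ! i'\<close> keeps it out of
    \<open>?leg\<close>.\<close>
  let ?arm = "{j'. j' < length cols \<and> ?g \<le> cols ! j' \<and> cols ! j' < ?b}"
  let ?leg = "{i'. i' < length rows \<and> ?g < rows ! i' \<and> rows ! i' < ?b}"
  have "{(i', j') \<in> diagram ?p. (i' = i \<and> j \<le> j') \<or> (j' = j \<and> i \<le> i')}
      = Pair i ` ?arm \<union> (\<lambda>i'. (i', j)) ` ?leg" (is "?H = _")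
  proof -
    have 1: "j \<le> j' \<longleftrightarrow> ?g \<le> cols ! j'" if "j' < length cols" for j'
      using cols_less_iff[of j' j] that j by (metis linorder_not_less)
    have 2: "i < i' \<longleftrightarrow> rows ! i' < ?b" if "i' < length rows" for i'
      using rows_less_iff[of i i'] that i by simp
    show ?thesis
    proof (intro set_eqI)
      fix z :: "nat \<times> nat"
      obtain i' j' where z: "z = (i', j')" by (cases z)
      have "z \<in> ?H \<longleftrightarrow> i' < length rows \<and> j' < length cols \<and> cols ! j' < rows ! i' \<and>
          ((i' = i \<and> j \<le> j') \<or> (j' = j \<and> i < i'))"
        using z diagram_iff by auto
      also have "\<dots> \<longleftrightarrow> z \<in> Pair i ` ?arm \<union> (\<lambda>i'. (i', j)) ` ?leg"
        using i j gb 1 2 z by auto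
      finally show "z \<in> ?H \<longleftrightarrow> z \<in> Pair i ` ?arm \<union> (\<lambda>i'. (i', j)) ` ?leg" .
    qed
  qed
  moreover have "card (Pair i ` ?arm \<union> (\<lambda>i'. (i', j)) ` ?leg) = card ?arm + card ?leg"
    by (subst card_Un_disjoint) (auto simp: card_image inj_on_def)
  moreover have "card ?arm = card ({?g..<?b} \<inter> G)"
    using card_nth_indices[OF distinct_cols, of "\<lambda>x. ?g \<le> x \<and> x < ?b"] rows_nth[OF i]
    by (auto simp: set_cols intro!: arg_cong[where f = card])
  moreover have "card ?leg = card ({?g..<?b} \<inter> A)"
  proof -
    have "{x \<in> set rows. ?g < x \<and> x < ?b} = {?g..<?b} \<inter> A"
    proof -
      have "?g \<in> G" "?g \<notin> A" using cols_nth[OF j] G by auto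
      then show ?thesis by (auto simp: set_rows less_le)
    qed
    then show ?thesis
      using card_nth_indices[OF distinct_rows, of "\<lambda>x. ?g < x \<and> x < ?b"] by simp
  qed
  moreover have "card ({?g..<?b} \<inter> G) + card ({?g..<?b} \<inter> A) = card {?g..<?b}"
  proof -
    have "({?g..<?b} \<inter> G) \<union> ({?g..<?b} \<inter> A) = {?g..<?b}" using G by blast
    then show ?thesis using G card_Un_disjoint[of "{?g..<?b} \<inter> G" "{?g..<?b} \<inter> A"] by auto
  qed
  ultimately show ?thesis using gb by (simp add: hook_length_def)
qed

lemma rho_part_of:
  assumes G: "G = - A"
  shows "rho l (part_of A G) = map (\<lambda>b. card {g \<in> G. b - int l < g \<and> g < b}) rows"
proof -
  have "card {j. (i, j) \<in> diagram (part_of A G) \<and> hook_length (part_of A G) i j < l}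
      = card {g \<in> G. rows ! i - int l < g \<and> g < rows ! i}" (is "card ?J = card ?C")
    if i: "i < length rows" for i
  proof -
    have "?J = {j. j < length cols \<and> rows ! i - int l < cols ! j \<and> cols ! j < rows ! i}"
      using i hook_length_eq[OF G, of i] by (force simp: diagram_iff)
    moreover have "?C = {g \<in> set cols. rows ! i - int l < g \<and> g < rows ! i}"
      using rows_nth[OF i] by (auto simp: set_cols)
    ultimately show ?thesis
      using card_nth_indices[OF distinct_cols, of "\<lambda>g. rows ! i - int l < g \<and> g < rows ! i"]
      by simp
  qed
  then show ?thesis by (auto simp: rho_def part_of_rows intro!: nth_equalityI)
qed

text \<open>A bead \<open>b\<close> with a gap at \<open>b - int l\<close> would give a box of hook
  length exactly \<open>l\<close>.\<close>

lemma core_imp_flush: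
  assumes G: "G = - A" and core: "core l (part_of A G)" and "0 < l" and b: "b \<in> A"
  shows "b - int l \<in> A"
proof (rule ccontr)
  assume "b - int l \<notin> A"
  then have "b - int l \<in> G" "b - int l < b" using G \<open>0 < l\<close> by auto
  then have "b - int l \<in> set cols" "b \<in> set rows"
    unfolding set_cols set_rows using b by blast+
  then obtain i j where ij: "i < length rows" "rows ! i = b" "j < length cols" "cols ! j = b - int l"
    by (metis in_set_conv_nth)
  then have "(i, j) \<in> diagram (part_of A G)" using \<open>0 < l\<close> by (simp add: diagram_iff)
  moreover from this have "hook_length (part_of A G) i j = l"
    using hook_length_eq[OF G, of i j] ij by simp
  ultimately show False using core by (auto simp: core_def)
qed

end

subsection \<open>The abaci of a partition\<close>

text \<open>A bead above a gap and that gap are both confined to the finite stretch between the full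
  and the empty end of the abacus.\<close>

lemma abacus_beads_gaps:
  assumes "abacus B"
  shows "beads_gaps B (- B)"
proof -
  obtain m n where m: "\<And>b. b < m \<Longrightarrow> b \<in> B" and n: "\<And>b. n < b \<Longrightarrow> b \<notin> B"
    using assms by (auto simp: abacus_def)
  have gap: "m \<le> g" if "g \<notin> B" for g using m[of g] that by (meson linorder_not_less)
  have bead: "b \<le> n" if "b \<in> B" for b using n[of b] that by (meson linorder_not_less)
  have between: "b \<in> {m..n} \<and> g \<in> {m..n}" if "b \<in> B" "g \<notin> B" "g < b" for b g
    using gap[of g] bead[of b] that by simp
  show ?thesis
  proof
    show "finite {b \<in> B. \<exists>g \<in> - B. g < b}" "finite {g \<in> - B. \<exists>b \<in> B. g < b}"
      by (rule finite_subset[of _ "{m..n}"]; use between in blast)+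
  qed
qed

text \<open>Only the members up to a chosen \<open>x\<close> compete for the minimum, and these are
  finitely many.\<close>

lemma int_set_has_Least:
  fixes X :: "int set"
  assumes ne: "X \<noteq> {}" and low: "\<And>x. x \<in> X \<Longrightarrow> m \<le> x"
  obtains N where "N \<in> X" "\<And>x. x \<in> X \<Longrightarrow> N \<le> x"
proof -
  obtain x where x: "x \<in> X" using ne by blast
  have fin: "finite (X \<inter> {m..x})" and ne': "X \<inter> {m..x} \<noteq> {}" using x low by auto
  have "Min (X \<inter> {m..x}) \<in> X" using Min_in[OF fin ne'] by simp
  moreover have "Min (X \<inter> {m..x}) \<le> y" if "y \<in> X" for y
  proof (cases "y \<le> x")
    case True
    then show ?thesis using Min_le[OF fin] that low by simp
  next
    case False
    then show ?thesis using Min_in[OF fin ne'] by simp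
  qed
  ultimately show ?thesis using that by blast
qed

lemma abacus_least_gap:
  assumes "abacus B"
  obtains N where "N \<notin> B" "\<And>b. b < N \<Longrightarrow> b \<in> B"
proof -
  obtain m n where m: "\<And>b. b < m \<Longrightarrow> b \<in> B" and n: "\<And>b. n < b \<Longrightarrow> b \<notin> B"
    using assms by (auto simp: abacus_def)
  have "- B \<noteq> {}" using n[of "n + 1"] by auto
  moreover have "m \<le> x" if "x \<in> - B" for x using that m by (metis ComplD linorder_not_less)
  ultimately obtain N where "N \<in> - B" "\<And>x. x \<in> - B \<Longrightarrow> N \<le> x"
    using int_set_has_Least[of "- B" m] by blast
  then show ?thesis using that[of N] by (metis ComplD ComplI linorder_not_less)
qed

text \<open>Of the \<open>xs ! i - N\<close> integers from the least gap \<open>N\<close> up to the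
  bead \<open>xs ! i\<close>, exactly \<open>i\<close> are beads; the rest are the gaps that the
  part counts. Since \<open>xs\<close> ascends while parts are read from the largest bead, the index
  is reversed.\<close>

lemma abacus_partition_nth:
  fixes xs :: "int list"
  assumes N: "N \<notin> B" "\<And>b. b < N \<Longrightarrow> b \<in> B"
    and xs: "sorted_wrt (<) xs" "set xs = {b \<in> B. N < b}"
  shows "length (abacus_partition B) = length xs"
    and "i < length xs \<Longrightarrow>
      int (abacus_partition B ! (length xs - 1 - i)) = xs ! i - N - int i"
proof -
  have "{b \<in> B. \<exists>g < b. g \<notin> B} = set xs"
    using N by (auto simp: xs(2)) (metis linorder_neqE_linordered_idom order_less_trans)
  then have ap: "abacus_partition B = map (\<lambda>b. card {g. g < b \<and> g \<notin> B}) (rev xs)"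
    using sorted_list_of_set_eqI[OF xs(1)] by (simp add: abacus_partition_def)
  then show "length (abacus_partition B) = length xs" by simp
  show "int (abacus_partition B ! (length xs - 1 - i)) = xs ! i - N - int i"
    if i: "i < length xs"
  proof -
    let ?b = "xs ! i"
    have b: "?b \<in> B" "N < ?b" using nth_mem[OF i] by (auto simp: xs(2))
    have below: "{x \<in> set xs. x < ?b} = {N..<?b} \<inter> B" using N by (auto simp: xs(2) less_le)
    have "{j. j < length xs \<and> xs ! j < ?b} = {..<i}"
      using xs(1) i unfolding sorted_wrt_iff_nth_less
      by auto (metis linorder_neqE_nat order_less_asym order_less_irrefl)
    then have "card ({N..<?b} \<inter> B) = i"
      using card_nth_indices[of xs "\<lambda>x. x < ?b"] xs(1) below by (simp add: strict_sorted_iff)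
    moreover have "card {g. g < ?b \<and> g \<notin> B} = card ({N..<?b} - B)"
      using N by (intro arg_cong[where f = card]) (auto, metis linorder_not_less)
    moreover have "card {N..<?b} = card ({N..<?b} \<inter> B) + card ({N..<?b} - B)"
    proof -
      have "({N..<?b} \<inter> B) \<union> ({N..<?b} - B) = {N..<?b}" by blast
      then show ?thesis using card_Un_disjoint[of "{N..<?b} \<inter> B" "{N..<?b} - B"] by auto
    qed
    moreover have "abacus_partition B ! (length xs - 1 - i) = card {g. g < ?b \<and> g \<notin> B}"
      
    proof -
      have "length xs - Suc (length xs - 1 - i) = i" using i by arith
      then have "rev xs ! (length xs - 1 - i) = xs ! i" using i by (subst rev_nth) auto
      moreover have "abacus_partition B ! (length xs - 1 - i)
          = (\<lambda>b. card {g. g < b \<and> g \<notin> B}) (rev xs ! (length xs - 1 - i))"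
        unfolding ap by (rule nth_map) (use i in simp)
      ultimately show ?thesis by (simp only:)
    qed
    ultimately show ?thesis using b by simp
  qed
qed

text \<open>By \<open>abacus_partition_nth\<close> the parts fix every bead above the least gap
  relative to that gap, so two abaci of one partition differ by the distance of their least
  gaps.\<close>

lemma abacus_partition_eq_imp_shift:
  assumes "abacus B" "abacus B'" "abacus_partition B = abacus_partition B'"
  obtains s where "B' = (\<lambda>b. b + s) ` B"
proof -
  obtain N where N: "N \<notin> B" "\<And>b. b < N \<Longrightarrow> b \<in> B" using abacus_least_gap[OF assms(1)] by blast
  obtain N' where N': "N' \<notin> B'" "\<And>b. b < N' \<Longrightarrow> b \<in> B'" using abacus_least_gap[OF assms(2)] by blast
  have fin: "finite {b \<in> X. M < b}" if X: "abacus X" for X M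
  proof -
    obtain n where "\<forall>b > n. b \<notin> X" using X unfolding abacus_def by blast
    then have "{b \<in> X. M < b} \<subseteq> {M..n}" by (auto, metis linorder_not_less)
    then show ?thesis by (rule finite_subset) simp
  qed
  obtain xs where xs: "sorted_wrt (<) xs" "set xs = {b \<in> B. N < b}"
    using fin[OF assms(1)] finite_set_strict_sorted by metis
  obtain xs' where xs': "sorted_wrt (<) xs'" "set xs' = {b \<in> B'. N' < b}"
    using fin[OF assms(2)] finite_set_strict_sorted by metis
  note nth = abacus_partition_nth[OF N xs] and nth' = abacus_partition_nth[OF N' xs']
  have len: "length xs' = length xs" using nth(1) nth'(1) assms(3) by simp
  have "xs' = map (\<lambda>b. b + (N' - N)) xs"
  proof (rule nth_equalityI)
    fix i assume "i < length xs'"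
    then show "xs' ! i = map (\<lambda>b. b + (N' - N)) xs ! i"
      using nth(2)[of i] nth'(2)[of i] len assms(3) by simp
  qed (simp add: len)
  then have *: "{b \<in> B'. N' < b} = (\<lambda>b. b + (N' - N)) ` {b \<in> B. N < b}"
    using xs xs' by (metis set_map)
  have "b \<in> B' \<longleftrightarrow> b - (N' - N) \<in> B" for b
  proof (cases "b \<le> N'")
    case True
    then show ?thesis using N N' by (cases "b = N'") auto
  next
    case False
    have "b \<in> B' \<longleftrightarrow> b \<in> (\<lambda>b. b + (N' - N)) ` {b \<in> B. N < b}"
      unfolding *[symmetric] using False by simp
    also have "\<dots> \<longleftrightarrow> b - (N' - N) \<in> B" using False by (force simp: image_iff)
    finally show ?thesis .
  qed
  then have "B' = (\<lambda>b. b + (N' - N)) ` B" by (force simp: image_iff)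
  then show ?thesis by (rule that)
qed

text \<open>The beads chosen are the negative integers and the first-column hook lengths of
  \<open>p\<close>, listed in increasing order by \<open>xs\<close>. Positive parts make 0 the least
  gap.\<close>

lemma ex_abacus:
  assumes p: "is_partition p"
  obtains B where "abacus B" "abacus_partition B = p"
proof -
  define n where "n = length p"
  define xs where "xs = map (\<lambda>i. int i + int (p ! (n - 1 - i))) [0..<n]"
  define B where "B = {..<0} \<union> set xs"
  have pos: "0 < p ! i" if "i < n" for i
    using p that nth_mem[of i p] by (metis bot_nat_0.not_eq_extremum is_partition_def n_def)
  have mono: "p ! j \<le> p ! i" if "i \<le> j" "j < n" for i j
    using p that by (cases "i = j") (auto simp: is_partition_def sorted_wrt_iff_nth_less n_def)
  have xs: "sorted_wrt (<) xs"
    unfolding sorted_wrt_iff_nth_less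
  proof (intro allI impI)
    fix i j assume "i < j" "j < length xs"
    then have "n - 1 - j \<le> n - 1 - i" "n - 1 - i < n" "j < n" by (simp_all add: xs_def)
    with \<open>i < j\<close> show "xs ! i < xs ! j" using mono[of "n - 1 - j" "n - 1 - i"] by (simp add: xs_def)
  qed
  have xpos: "0 < x" if "x \<in> set xs" for x
    using that by (auto simp: xs_def intro!: add_nonneg_pos pos)
  have B: "(0::int) \<notin> B" "\<And>b. b < 0 \<Longrightarrow> b \<in> B" "set xs = {b \<in> B. 0 < b}"
    using xpos by (auto simp: B_def)
  have "abacus_partition B = p"
  proof (rule nth_equalityI)
    show len: "length (abacus_partition B) = length p"
      using abacus_partition_nth(1)[OF B(1,2) xs B(3)] by (simp add: xs_def n_def)
    fix i assume "i < length (abacus_partition B)"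
    then have i: "i < n" using len n_def by simp
    then show "abacus_partition B ! i = p ! i"
      using abacus_partition_nth(2)[OF B(1,2) xs B(3), of "n - 1 - i"] by (simp add: xs_def)
  qed
  moreover have "abacus B"
  proof -
    have "b \<notin> B" if "b > Max (insert 0 (set xs))" for b
      using that by (auto simp: B_def)
    then show ?thesis using B(2) unfolding abacus_def by blast
  qed
  ultimately show ?thesis using that by blast
qed

subsection \<open>Deleting a runner\<close>

text \<open>The renumbering inside \<open>delete_runner\<close>, isolated as a map on positions. Off
  runner \<open>c\<close> it turns out to be an order isomorphism onto the integers.\<close>

definition squeeze :: "nat \<Rightarrow> int \<Rightarrow> int \<Rightarrow> int" where
  "squeeze l c b = (b div int l) * (int l - 1) + (if b mod int l < c then b mod int l else b mod int l - 1)"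

lemma delete_runner_eq: "delete_runner l c B = squeeze l c ` {b \<in> B. b mod int l \<noteq> c}"
  by (auto simp: delete_runner_def squeeze_def)

lemma strict_mono_on_squeeze:
  assumes l: "2 \<le> l" and c: "0 \<le> c" "c < int l"
  shows "strict_mono_on {b. b mod int l \<noteq> c} (squeeze l c)"
proof (rule strict_mono_onI)
  fix x y assume xy: "x \<in> {b. b mod int l \<noteq> c}" "y \<in> {b. b mod int l \<noteq> c}" "x < y"
  have le: "x div int l \<le> y div int l" using xy l by (simp add: zdiv_mono1)
  show "squeeze l c x < squeeze l c y"
  proof (cases "x div int l = y div int l")
    case True
    then have "x div int l * int l = y div int l * int l" by simp
    then have "x mod int l < y mod int l"
      using xy(3) div_mult_mod_eq[of x "int l"] div_mult_mod_eq[of y "int l"] by linarith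
    then show ?thesis using True xy by (auto simp: squeeze_def)
  next
    case False
    then have "x div int l + 1 \<le> y div int l" using le by simp
    \<comment> \<open>A higher level gains at least \<open>int l - 1\<close>, whereas the new runner
      numbers lie between 0 and \<open>int l - 2\<close> and cannot make up for it.\<close>
    then have "(x div int l + 1) * (int l - 1) \<le> (y div int l) * (int l - 1)"
      using l by (intro mult_right_mono) auto
    moreover define P Q where "P = (x div int l) * (int l - 1)" and "Q = (y div int l) * (int l - 1)"
    ultimately have "P + (int l - 1) \<le> Q" by (simp add: distrib_right)
    moreover have "x mod int l < int l" "0 \<le> y mod int l" using l by simp_all
    ultimately show ?thesis using xy c unfolding squeeze_def P_def[symmetric] Q_def[symmetric]
      by (smt (verit) mem_Collect_eq)
  qed
qed

lemma squeeze_surj: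
  assumes l: "2 \<le> l" and c: "0 \<le> c" "c < int l"
  obtains b where "b mod int l \<noteq> c" "squeeze l c b = y"
proof -
  define q s where "q = y div (int l - 1)" and "s = y mod (int l - 1)"
  have s: "0 \<le> s" "s < int l - 1" using l by (simp_all add: s_def)
  \<comment> \<open>Undoes the move to the left: new runners from \<open>c\<close> onwards step over
    the deleted one.\<close>
  define t where "t = (if s < c then s else s + 1)"
  have t: "0 \<le> t" "t < int l" "t \<noteq> c" using s c by (auto simp: t_def)
  have "(q * int l + t) mod int l = t" "(q * int l + t) div int l = q"
    using t by (simp_all add: div_add1_eq)
  moreover have "q * (int l - 1) + s = y" unfolding q_def s_def by (rule div_mult_mod_eq)
  ultimately have "squeeze l c (q * int l + t) = y" "(q * int l + t) mod int l \<noteq> c"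
    using t by (auto simp: squeeze_def t_def split: if_splits)
  then show ?thesis using that by blast
qed

text \<open>One level up stays one level up; this turns windows of length \<open>l\<close> into
  windows of length \<open>l - 1\<close>.\<close>

lemma squeeze_add: "0 < l \<Longrightarrow> squeeze l c (b + int l) = squeeze l c b + int (l - 1)"
  
  by (simp add: squeeze_def div_add_self2 distrib_right of_nat_diff)

text \<open>Since \<open>squeeze\<close> is injective and onto off runner \<open>c\<close>, each new
  position comes from one old position and inherits its status, so the new gaps are the old gaps
  renumbered.\<close>

lemma Compl_delete_runner:
  assumes "2 \<le> l" and "0 \<le> c" "c < int l"
  shows "- delete_runner l c B = squeeze l c ` {b \<in> - B. b mod int l \<noteq> c}"
proof -
  have "squeeze l c x = squeeze l c y \<longleftrightarrow> x = y" if "x mod int l \<noteq> c" "y mod int l \<noteq> c" for x y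
    using strict_mono_on_eqD[OF strict_mono_on_squeeze[OF assms]] that by auto
  moreover have "\<exists>b. b mod int l \<noteq> c \<and> y = squeeze l c b" for y
    using squeeze_surj[OF assms, of y] by metis
  ultimately show ?thesis unfolding delete_runner_eq by blast
qed

text \<open>Used to keep the finiteness conditions when a runner is left out.\<close>

lemma beads_gaps_subset:
  assumes "beads_gaps A G" "A' \<subseteq> A" "G' \<subseteq> G"
  shows "beads_gaps A' G'"
proof
  show "finite {b \<in> A'. \<exists>g \<in> G'. g < b}"
    by (rule finite_subset[OF _ beads_gaps.fin_rows[OF assms(1)]]) (use assms in blast)
  show "finite {g \<in> G'. \<exists>b \<in> A'. g < b}"
    by (rule finite_subset[OF _ beads_gaps.fin_cols[OF assms(1)]]) (use assms in blast)
qed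

text \<open>Renumbering preserves order, so by \<open>part_of_image\<close> the partition can be
  read off in the old coordinates.\<close>

lemma abacus_partition_delete_runner:
  assumes B: "abacus B" and "2 \<le> l" "0 \<le> c" "c < int l"
  shows "abacus_partition (delete_runner l c B)
    = part_of {b \<in> B. b mod int l \<noteq> c} {b \<in> - B. b mod int l \<noteq> c}"
proof -
  interpret beads_gaps "{b \<in> B. b mod int l \<noteq> c}" "{b \<in> - B. b mod int l \<noteq> c}"
    by (rule beads_gaps_subset[OF abacus_beads_gaps[OF B]]) auto
  show ?thesis
    unfolding abacus_partition_eq Compl_delete_runner[OF assms(2-)]
    unfolding delete_runner_eq
    by (rule part_of_image[OF monotone_on_subset[OF strict_mono_on_squeeze[OF assms(2-)]] fin_rows])
      auto
qed

text \<open>Expresses \<open>rho (l - 1)\<close> in the old coordinates, with windows of length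
  \<open>l\<close>: by \<open>squeeze_add\<close> the new lower bound on a gap \<open>g\<close> says
  that \<open>g + int l\<close> lies above \<open>b\<close>, and \<open>squeeze\<close> preserves
  that comparison.\<close>

lemma rho_delete_runner:
  assumes B: "abacus B" and l: "2 \<le> l" and c: "0 \<le> c" "c < int l"
  shows "rho (l - 1) (abacus_partition (delete_runner l c B))
    = map (\<lambda>b. card {g \<in> - B. g mod int l \<noteq> c \<and> b - int l < g \<and> g < b})
        (rev (sorted_list_of_set {b \<in> B. b mod int l \<noteq> c \<and> (\<exists>g \<in> - B. g mod int l \<noteq> c \<and> g < b)}))"
proof -
  define V where "V = {b. b mod int l \<noteq> c}"
  define \<phi> where "\<phi> = squeeze l c"
  define D where "D = delete_runner l c B"
  interpret U: beads_gaps "B \<inter> V" "V - B"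
    by (rule beads_gaps_subset[OF abacus_beads_gaps[OF B]]) auto
  have D: "D = \<phi> ` (B \<inter> V)" "- D = \<phi> ` (V - B)"
    unfolding D_def Compl_delete_runner[OF l c] unfolding delete_runner_eq
    by (auto simp: V_def \<phi>_def)
  have mono: "strict_mono_on V \<phi>" unfolding V_def \<phi>_def by (rule strict_mono_on_squeeze[OF l c])
  have less: "\<phi> x < \<phi> y \<longleftrightarrow> x < y" if "x \<in> V" "y \<in> V" for x y
    using strict_mono_on_less[OF mono] that by blast
  have rows: "{b \<in> D. \<exists>g \<in> - D. g < b} = \<phi> ` {b \<in> B \<inter> V. \<exists>g \<in> V - B. g < b}"
    unfolding D(2) unfolding D(1) using less by auto
  have cols: "{g \<in> - D. \<exists>b \<in> D. g < b} = \<phi> ` {g \<in> V - B. \<exists>b \<in> B \<inter> V. g < b}"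
    unfolding D(2) unfolding D(1) using less by auto
  interpret W: beads_gaps D "- D"
    by unfold_locales (simp_all only: rows cols U.fin_rows U.fin_cols finite_imageI)
  have "W.rows = map \<phi> U.rows"
    unfolding W.rows_def U.rows_def rows
    by (subst sorted_list_of_set_image[OF U.fin_rows monotone_on_subset[OF mono]])
      (auto simp: rev_map)
  moreover have "card {g \<in> - D. \<phi> b - int (l - 1) < g \<and> g < \<phi> b}
      = card {g \<in> - B. g mod int l \<noteq> c \<and> b - int l < g \<and> g < b}" if b: "b \<in> V" for b
  proof -
    have "\<phi> b - int (l - 1) < \<phi> g \<longleftrightarrow> b - int l < g" if "g \<in> V" for g
    proof -
      have "g + int l \<in> V" using that by (simp add: V_def)
      then have "\<phi> b < \<phi> (g + int l) \<longleftrightarrow> b < g + int l" using less b by blast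
      then show ?thesis using squeeze_add[of l c g] l by (simp add: \<phi>_def algebra_simps)
    qed
    then have "{g \<in> V - B. \<phi> b - int (l - 1) < \<phi> g \<and> \<phi> g < \<phi> b}
        = {g \<in> V - B. b - int l < g \<and> g < b}"
      using less[OF _ b] by blast
    moreover have "{g \<in> - D. \<phi> b - int (l - 1) < g \<and> g < \<phi> b}
        = \<phi> ` {g \<in> V - B. \<phi> b - int (l - 1) < \<phi> g \<and> \<phi> g < \<phi> b}"
      unfolding D(2) by blast
    ultimately have "{g \<in> - D. \<phi> b - int (l - 1) < g \<and> g < \<phi> b}
        = \<phi> ` {g \<in> V - B. b - int l < g \<and> g < b}"
      by simp
    also have "card \<dots> = card {g \<in> V - B. b - int l < g \<and> g < b}"
      by (rule card_image, rule inj_on_subset[OF strict_mono_on_imp_inj_on[OF mono]]) auto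
    also have "{g \<in> V - B. b - int l < g \<and> g < b}
        = {g \<in> - B. g mod int l \<noteq> c \<and> b - int l < g \<and> g < b}"
      by (auto simp: V_def)
    finally show ?thesis .
  qed
  moreover have "{b \<in> B \<inter> V. \<exists>g \<in> V - B. g < b}
      = {b \<in> B. b mod int l \<noteq> c \<and> (\<exists>g \<in> - B. g mod int l \<noteq> c \<and> g < b)}"
    by (auto simp: V_def)
  ultimately show ?thesis
    unfolding D_def[symmetric] abacus_partition_eq W.rho_part_of[OF refl]
    using U.fin_rows by (auto simp: U.rows_def)
qed

text \<open>Resolves the definite description in \<open>Phi\<close>. Any other abacus of the
  partition is a shift, which carries the largest bead and its whole runner along.\<close>

lemma Phi_abacus_partition:
  assumes B: "abacus B" and l: "2 \<le> l" and M: "M \<in> B" "\<And>b. b \<in> B \<Longrightarrow> b \<le> M"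
  shows "Phi l (abacus_partition B) = abacus_partition (delete_runner l (M mod int l) B)"
proof -
  have greatest: "delete_largest_bead_runner l X = delete_runner l (N mod int l) X"
    if "N \<in> X" "\<And>b. b \<in> X \<Longrightarrow> b \<le> N" for X N
    unfolding delete_largest_bead_runner_def using Greatest_equality[of "\<lambda>b. b \<in> X" N] that by auto
  show ?thesis
    unfolding Phi_def
  proof (rule the_equality)
    show "\<exists>B'. abacus B' \<and> abacus_partition B' = abacus_partition B \<and>
        abacus_partition (delete_runner l (M mod int l) B)
          = abacus_partition (delete_largest_bead_runner l B')"
      using B greatest[OF M] by auto
    fix q
    assume "\<exists>B'. abacus B' \<and> abacus_partition B' = abacus_partition B \<and>
        q = abacus_partition (delete_largest_bead_runner l B')"
    then obtain B' where B': "abacus B'" "abacus_partition B = abacus_partition B'"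
      and q: "q = abacus_partition (delete_largest_bead_runner l B')" by auto
    obtain s where s: "B' = (\<lambda>b. b + s) ` B"
      using abacus_partition_eq_imp_shift[OF B B'] by blast
    have mod: "(b + s) mod int l = (M + s) mod int l \<longleftrightarrow> b mod int l = M mod int l" for b
      by (simp add: mod_eq_dvd_iff)
    let ?A = "{b \<in> B. b mod int l \<noteq> M mod int l}" and ?G = "{b \<in> - B. b mod int l \<noteq> M mod int l}"
    interpret beads_gaps ?A ?G
      by (rule beads_gaps_subset[OF abacus_beads_gaps[OF B]]) auto
    have "q = abacus_partition (delete_runner l ((M + s) mod int l) B')"
    proof -
      have "M + s \<in> B'" "\<And>b. b \<in> B' \<Longrightarrow> b \<le> M + s" using M by (auto simp: s)
      from greatest[OF this] show ?thesis by (simp add: q)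
    qed
    \<comment> \<open>The comparison takes place before renumbering, because a shift can permute the
      runners cyclically and change levels.\<close>
    also have "\<dots> = part_of {b \<in> B'. b mod int l \<noteq> (M + s) mod int l}
        {b \<in> - B'. b mod int l \<noteq> (M + s) mod int l}"
      by (rule abacus_partition_delete_runner[OF B'(1) l]) (use l in auto)
    also have "{b \<in> B'. b mod int l \<noteq> (M + s) mod int l} = (\<lambda>b. b + s) ` ?A"
      using mod by (auto simp: s)
    also have "{b \<in> - B'. b mod int l \<noteq> (M + s) mod int l} = (\<lambda>b. b + s) ` ?G"
    proof -
      have "b \<in> B' \<longleftrightarrow> b - s \<in> B" for b by (force simp: s)
      then show ?thesis using mod[of "_ - s"] by (force simp: image_iff)
    qed
    also have "part_of ((\<lambda>b. b + s) ` ?A) ((\<lambda>b. b + s) ` ?G) = part_of ?A ?G"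
      by (rule part_of_image[OF _ fin_rows]) (auto intro: strict_mono_onI)
    also have "\<dots> = abacus_partition (delete_runner l (M mod int l) B)"
      by (rule abacus_partition_delete_runner[OF B l, symmetric]) (use l in auto)
    finally show "q = abacus_partition (delete_runner l (M mod int l) B)" .
  qed
qed

text \<open>In the reflected abacus \<open>B\<close> the largest bead is \<open>- m\<close>, and its
  runner is the mirror image of the runner of \<open>m\<close>. The second transposition is carried
  out with \<open>part_of\<close> in the old coordinates, where it is again a reflection.\<close>

lemma Phi_tilde_abacus_partition:
  assumes A: "abacus A" and l: "2 \<le> l" and m: "m \<notin> A" "\<And>b. b < m \<Longrightarrow> b \<in> A"
  shows "Phi_tilde l (abacus_partition A) = abacus_partition (delete_runner l (m mod int l) A)"
proof -
  define B where "B = uminus ` (- A)"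
  have memB: "x \<in> B \<longleftrightarrow> - x \<notin> A" for x by (force simp: B_def)
  then have CB: "- B = uminus ` A" by (force simp: image_iff)
  have "abacus B"
  proof -
    obtain a b where "\<And>x. x < a \<Longrightarrow> x \<in> A" "\<And>x. b < x \<Longrightarrow> x \<notin> A"
      using A by (auto simp: abacus_def)
    then have "\<forall>x < - b. x \<in> B" "\<forall>x > - a. x \<notin> B" by (auto simp: memB)
    then show ?thesis unfolding abacus_def by blast
  qed
  have mod: "(- x) mod int l = (- m) mod int l \<longleftrightarrow> x mod int l = m mod int l" for x
    unfolding mod_eq_dvd_iff using dvd_diff_commute[of "int l" m x] by simp
  have neg: "uminus ` X = {x. - x \<in> X}" for X :: "int set" by force
  let ?B = "{b \<in> B. b mod int l \<noteq> (- m) mod int l}" and ?G = "{b \<in> - B. b mod int l \<noteq> (- m) mod int l}"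
  interpret A: beads_gaps A "- A" by (rule abacus_beads_gaps[OF A])
  interpret B: beads_gaps ?B ?G
    by (rule beads_gaps_subset[OF abacus_beads_gaps[OF \<open>abacus B\<close>]]) auto
  have "tr (abacus_partition A) = abacus_partition B"
    by (simp add: abacus_partition_eq A.tr_part_of CB) (simp add: B_def)
  moreover have "Phi l (abacus_partition B) = abacus_partition (delete_runner l ((- m) mod int l) B)"
  proof (rule Phi_abacus_partition[OF \<open>abacus B\<close> l])
    show "b \<le> - m" if "b \<in> B" for b using m(2)[of "- b"] that by (force simp: memB)
  qed (simp add: memB m)
  moreover have "abacus_partition (delete_runner l ((- m) mod int l) B) = part_of ?B ?G"
    by (rule abacus_partition_delete_runner[OF \<open>abacus B\<close> l]) (use l in auto)
  moreover have "uminus ` ?G = {b \<in> A. b mod int l \<noteq> m mod int l}"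
    by (intro set_eqI) (simp only: neg memB mod mem_Collect_eq Compl_iff minus_minus not_not)
  moreover have "uminus ` ?B = {b \<in> - A. b mod int l \<noteq> m mod int l}"
    by (intro set_eqI) (simp only: neg memB mod mem_Collect_eq Compl_iff minus_minus not_not)
  moreover have "part_of {b \<in> A. b mod int l \<noteq> m mod int l} {b \<in> - A. b mod int l \<noteq> m mod int l}
      = abacus_partition (delete_runner l (m mod int l) A)"
    by (rule abacus_partition_delete_runner[OF A l, symmetric]) (use l in auto)
  ultimately show ?thesis by (simp only: Phi_tilde_def o_apply B.tr_part_of)
qed

subsection \<open>Deleting the first column\<close>

text \<open>Only the number of parts equal to 1 is lost. They stand at the end, so the original
  length restores them.\<close>

lemma Upsilon_inverse:
  assumes "is_partition \<nu>"
  shows "map Suc (Upsilon \<nu>) @ replicate (length \<nu> - length (Upsilon \<nu>)) 1 = \<nu>"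
  using assms
proof (induction \<nu>)
  case Nil
  then show ?case by (simp add: Upsilon_def)
next
  case (Cons x \<nu>)
  have x: "0 < x" "\<forall>y \<in> set \<nu>. y \<le> x" and \<nu>: "is_partition \<nu>"
    using Cons.prems by (auto simp: is_partition_def)
  show ?case
  proof (cases "x = 1")
    case True
    then have all: "y = 1" if "y \<in> set \<nu>" for y
    proof -
      have "y \<noteq> 0" using \<nu> that by (metis is_partition_def)
      moreover have "y \<le> 1" using x(2) that True by simp
      ultimately show ?thesis by simp
    qed
    then have "\<nu> = replicate (length \<nu>) 1" by (metis replicate_eqI)
    moreover have "Upsilon (x # \<nu>) = []" using True all by (auto simp: Upsilon_def filter_empty_conv)
    ultimately show ?thesis using True by simp
  next
    case False
    then show ?thesis using x Cons.IH[OF \<nu>] by (simp add: Upsilon_def)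
  qed
qed

lemma first_part_le_iff:
  assumes "is_partition p"
  shows "first_part p \<le> n \<longleftrightarrow> (\<forall>x \<in> set p. x \<le> n)"
  using assms by (cases p) (auto simp: first_part_def is_partition_def)

lemma bij_betw_Upsilon:
  assumes "2 \<le> l"
  shows "bij_betw Upsilon
    {\<nu>. is_partition \<nu> \<and> first_part \<nu> \<le> l - 1 \<and> length \<nu> = k}
    {\<sigma>. is_partition \<sigma> \<and> first_part \<sigma> \<le> l - 2 \<and> length \<sigma> \<le> k}"
    (is "bij_betw _ ?S ?T")
proof (rule bij_betw_byWitness)
  \<comment> \<open>The inverse puts a column of height \<open>k\<close> in front of the
    diagram.\<close>
  let ?g = "\<lambda>\<sigma>. map Suc \<sigma> @ replicate (k - length \<sigma>) 1"
  show "\<forall>\<nu> \<in> ?S. ?g (Upsilon \<nu>) = \<nu>" using Upsilon_inverse by auto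
  show "\<forall>\<sigma> \<in> ?T. Upsilon (?g \<sigma>) = \<sigma>"
  proof
    fix \<sigma> assume "\<sigma> \<in> ?T"
    then have "0 \<notin> set \<sigma>" by (simp add: is_partition_def)
    then have "\<forall>x \<in> set \<sigma>. 0 < x" by (metis gr0I)
    then have "filter (\<lambda>x. 0 < x) \<sigma> = \<sigma>" by (rule filter_True)
    then show "Upsilon (?g \<sigma>) = \<sigma>" by (simp add: Upsilon_def comp_def)
  qed
  show "Upsilon ` ?S \<subseteq> ?T"
  proof (rule image_subsetI)
    fix \<nu> assume "\<nu> \<in> ?S"
    then have \<nu>: "is_partition \<nu>" "\<forall>x \<in> set \<nu>. x \<le> l - 1" "length \<nu> = k"
      using first_part_le_iff by auto
    have "sorted_wrt (\<ge>) (map (\<lambda>x. x - 1) \<nu>)"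
      unfolding sorted_wrt_map
      by (rule sorted_wrt_mono_rel[of \<nu> "(\<ge>)"]) (use \<nu>(1) in \<open>auto simp: is_partition_def\<close>)
    then have p: "is_partition (Upsilon \<nu>)"
      by (simp add: is_partition_def Upsilon_def sorted_wrt_filter)
    moreover have "\<forall>x \<in> set (Upsilon \<nu>). x \<le> l - 2"
      using \<nu>(2) by (fastforce simp: Upsilon_def)
    moreover have "length (Upsilon \<nu>) \<le> k"
      unfolding Upsilon_def using length_filter_le[of _ "map (\<lambda>x. x - 1) \<nu>"] \<nu>(3) by simp
    ultimately show "Upsilon \<nu> \<in> ?T" using first_part_le_iff[OF p] by simp
  qed
  show "?g ` ?T \<subseteq> ?S"
  proof (rule image_subsetI)
    fix \<sigma> assume "\<sigma> \<in> ?T"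
    then have \<sigma>: "is_partition \<sigma>" "\<forall>x \<in> set \<sigma>. x \<le> l - 2" "length \<sigma> \<le> k"
      using first_part_le_iff by auto
    have "sorted_wrt (\<ge>) (replicate (k - length \<sigma>) (1::nat))"
      by (simp add: sorted_wrt_iff_nth_less)
    then have p: "is_partition (?g \<sigma>)"
      using \<sigma>(1) by (auto simp: is_partition_def sorted_wrt_append sorted_wrt_map)
    \<comment> \<open>From \<open>2 \<le> l\<close>, a raised part is at most
      \<open>Suc (l - 2) = l - 1\<close>, and the padding value 1 is within the bound too.\<close>
    moreover have "\<forall>x \<in> set (?g \<sigma>). x \<le> l - 1" using \<sigma>(2) assms by fastforce
    ultimately show "?g \<sigma> \<in> ?S" using \<sigma>(3) first_part_le_iff[OF p] by simp
  qed
qed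

subsection \<open>Abaci of cores\<close>

text \<open>The property that \<open>core_imp_flush\<close> extracts from a core, with
  \<open>m\<close> as the least gap.\<close>

locale flush_abacus =
  fixes l :: nat and A :: "int set" and m :: int
  assumes l: "2 \<le> l" and A: "abacus A"
    and flush: "b \<in> A \<Longrightarrow> b - int l \<in> A"
    and m: "m \<notin> A" "b < m \<Longrightarrow> b \<in> A"
begin

lemma gap_above:
  assumes "g \<notin> A" "0 \<le> q"
  shows "g + int l * q \<notin> A"
proof -
  have "g + int l * int n \<notin> A" for n
  proof (induction n)
    case (Suc n)
    then show ?case using flush[of "g + int l * int (Suc n)"] by (auto simp: algebra_simps)
  qed (use assms in simp)
  from this[of "nat q"] show ?thesis using assms(2) by simp
qed

text \<open>Such a bead lies above the least gap \<open>m\<close>. On the runner of \<open>m\<close>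
  it would be \<open>m\<close> raised by whole levels, which is a gap by
  \<open>gap_above\<close>.\<close>

lemma bead_above_gap:
  assumes b: "b \<in> A" "g \<notin> A" "g < b"
  shows "m < b" "b mod int l \<noteq> m mod int l"
proof -
  have "m \<le> g" using m(2)[of g] b(2) by (meson linorder_not_less)
  then show "m < b" using b(3) by simp
  show "b mod int l \<noteq> m mod int l"
  proof
    assume "b mod int l = m mod int l"
    then obtain q where q: "b = m + int l * q"
      by (metis mod_eq_dvd_iff dvdE add.commute diff_add_cancel)
    then have "0 \<le> q" using \<open>m < b\<close> l by (simp add: zero_less_mult_iff)
    then show False using gap_above[OF m(1)] q b(1) by simp
  qed
qed

lemma card_window:
  assumes b: "b \<in> A" "g \<notin> A" "g < b"
  shows "card {g \<in> - A. b - int l < g \<and> g < b}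
    = Suc (card {g \<in> - A. g mod int l \<noteq> m mod int l \<and> b - int l < g \<and> g < b})"
proof -
  \<comment> \<open>The last position up to \<open>b\<close> on the runner of \<open>m\<close>. As
    \<open>b\<close> is on another runner, \<open>x\<close> lies strictly inside the window, and
    being at or above \<open>m\<close> it is a gap.\<close>
  define x where "x = m + int l * ((b - m) div int l)"
  have mb: "m < b" "b mod int l \<noteq> m mod int l" using bead_above_gap[OF b] .
  have "x = b - (b - m) mod int l"
    using mult_div_mod_eq[of "int l" "b - m"] unfolding x_def by linarith
  moreover have "(b - m) mod int l < int l" "0 \<le> (b - m) mod int l" using l by simp_all
  moreover have "(b - m) mod int l \<noteq> 0" using mb(2) by (simp add: mod_eq_dvd_iff dvd_eq_mod_eq_0)
  ultimately have x: "b - int l < x" "x < b" by linarith+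
  have "x \<notin> A" unfolding x_def
    by (rule gap_above[OF m(1)]) (use mb l in \<open>simp add: pos_imp_zdiv_nonneg_iff\<close>)
  have xm: "x mod int l = m mod int l" by (simp add: x_def)
  have uniq: "g = x" if "b - int l < g" "g < b" "g mod int l = m mod int l" for g
  proof -
    have "int l dvd g - x" using that xm by (simp add: mod_eq_dvd_iff[symmetric])
    moreover have "\<bar>g - x\<bar> < int l" using that x by linarith
    ultimately show ?thesis using zdvd_imp_le[of "int l" "\<bar>g - x\<bar>"] by fastforce
  qed
  have "{g \<in> - A. b - int l < g \<and> g < b}
      = insert x {g \<in> - A. g mod int l \<noteq> m mod int l \<and> b - int l < g \<and> g < b}"
    (is "?W = insert x ?W'")
  proof (rule set_eqI)
    show "g \<in> ?W \<longleftrightarrow> g \<in> insert x ?W'" for g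
      using x \<open>x \<notin> A\<close> uniq[of g] by blast
  qed
  moreover have "finite {g \<in> - A. g mod int l \<noteq> m mod int l \<and> b - int l < g \<and> g < b}"
    by (rule finite_subset[of _ "{b - int l..b}"]) auto
  ultimately show ?thesis using xm by simp
qed

text \<open>A gap anywhere below \<open>b\<close> can be raised along its runner, staying a gap,
  until it enters the window.\<close>

lemma window_nonempty_iff:
  assumes b: "b \<in> A"
  shows "0 < card {g \<in> - A. g mod int l \<noteq> c \<and> b - int l < g \<and> g < b}
    \<longleftrightarrow> (\<exists>g \<in> - A. g mod int l \<noteq> c \<and> g < b)"
proof -
  let ?W = "{g \<in> - A. g mod int l \<noteq> c \<and> b - int l < g \<and> g < b}"
  have "finite ?W" by (rule finite_subset[of _ "{b - int l..b}"]) auto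
  then have "0 < card ?W \<longleftrightarrow> ?W \<noteq> {}" by (simp add: card_gt_0_iff)
  moreover have "?W \<noteq> {}" if g: "g \<notin> A" "g mod int l \<noteq> c" "g < b" for g
  proof -
    \<comment> \<open>Measuring from \<open>b - 1\<close> keeps \<open>y\<close> strictly below
      \<open>b\<close>. The lower end \<open>b - int l\<close> remains possible at first and is then
      excluded because it is a bead by \<open>flush\<close>.\<close>
    define y where "y = g + int l * ((b - 1 - g) div int l)"
    have "y = b - 1 - (b - 1 - g) mod int l"
      using mult_div_mod_eq[of "int l" "b - 1 - g"] unfolding y_def by linarith
    moreover have "(b - 1 - g) mod int l < int l" "0 \<le> (b - 1 - g) mod int l" using l by simp_all
    ultimately have y: "b - int l \<le> y" "y < b" by linarith+
    have "y \<notin> A" unfolding y_def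
      by (rule gap_above[OF g(1)]) (use g l in \<open>simp add: pos_imp_zdiv_nonneg_iff\<close>)
    moreover have "y \<noteq> b - int l" using \<open>y \<notin> A\<close> flush[OF b] by auto
    moreover have "y mod int l = g mod int l" by (simp add: y_def)
    ultimately have "y \<in> ?W" using y g(2) by auto
    then show ?thesis by blast
  qed
  ultimately show ?thesis by blast
qed

lemma Upsilon_rho:
  "Upsilon (rho l (abacus_partition A)) = rho (l - 1) (Phi_tilde l (abacus_partition A))"
proof -
  interpret beads_gaps A "- A" by (rule abacus_beads_gaps[OF A])
  let ?f = "\<lambda>b. card {g \<in> - A. b - int l < g \<and> g < b}"
  let ?f' = "\<lambda>b. card {g \<in> - A. g mod int l \<noteq> m mod int l \<and> b - int l < g \<and> g < b}"
  have "?f b - 1 = ?f' b" if "b \<in> set rows" for b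
    using that card_window[of b] by (auto simp: set_rows)
  then have "map (\<lambda>x. x - 1) (map ?f rows) = map ?f' rows" by simp
  then have "Upsilon (rho l (abacus_partition A)) = map ?f' (filter (\<lambda>b. 0 < ?f' b) rows)"
    by (simp only: Upsilon_def abacus_partition_eq rho_part_of[OF refl] filter_map comp_def)
  also have "filter (\<lambda>b. 0 < ?f' b) rows
      = rev (sorted_list_of_set {b \<in> {b \<in> A. \<exists>g \<in> - A. g < b}. 0 < ?f' b})"
    by (simp only: rows_def rev_filter[symmetric] filter_sorted_list_of_set[OF fin_rows])
  \<comment> \<open>The rows that survive \<open>Upsilon\<close> are matched with the rows after
    deletion: \<open>window_nonempty_iff\<close> supplies the remaining gap,
    \<open>bead_above_gap\<close> the residue of the bead.\<close>
  also have "{b \<in> {b \<in> A. \<exists>g \<in> - A. g < b}. 0 < ?f' b}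
      = {b \<in> A. b mod int l \<noteq> m mod int l \<and> (\<exists>g \<in> - A. g mod int l \<noteq> m mod int l \<and> g < b)}"
    using window_nonempty_iff bead_above_gap(2) by blast
  also have "map ?f' (rev (sorted_list_of_set \<dots>))
      = rho (l - 1) (abacus_partition (delete_runner l (m mod int l) A))"
    by (rule rho_delete_runner[OF A l, symmetric]) (use l in auto)
  finally show ?thesis using Phi_tilde_abacus_partition[OF A l m] by simp
qed

end

theorem theorem4p5p1p3:
  fixes l k :: nat
  assumes "2 \<le> l"
  shows "bij_betw Upsilon
           {\<nu>. is_partition \<nu> \<and> first_part \<nu> \<le> l - 1 \<and> length \<nu> = k}
           {\<sigma>. is_partition \<sigma> \<and> first_part \<sigma> \<le> l - 2 \<and> length \<sigma> \<le> k}
         \<and> (\<forall>p. core l p \<and> length p = k \<longrightarrow>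
               (Upsilon \<circ> rho l) p = (rho (l - 1) \<circ> Phi_tilde l) p)"
proof (intro conjI allI impI)
  fix p assume "core l p \<and> length p = k"
  then have core: "core l p" ..
  then have "is_partition p" by (simp add: core_def)
  then obtain A where A: "abacus A" and p: "abacus_partition A = p" using ex_abacus by blast
  obtain m where m: "m \<notin> A" "\<And>b. b < m \<Longrightarrow> b \<in> A"
    using abacus_least_gap[OF A] by blast
  interpret beads_gaps A "- A" by (rule abacus_beads_gaps[OF A])
  have core': "core l (part_of A (- A))" using core unfolding p[symmetric] abacus_partition_eq .
  \<comment> \<open>From here on the core enters only through this property of its abacus.\<close>
  have "b - int l \<in> A" if "b \<in> A" for b
    using core_imp_flush[OF refl core' _ that] assms by simp
  then interpret flush_abacus l A m
    using assms A m by unfold_locales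
  show "(Upsilon \<circ> rho l) p = (rho (l - 1) \<circ> Phi_tilde l) p"
    using Upsilon_rho p by simp
qed (rule bij_betw_Upsilon[OF assms])

end
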